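(* Let $d\ge 1$, $\mathcal D=[0,1]^d$, let $\mathbf l=(l_1,\dots,l_k)$ be a decomposition vector of $d$, and let $\boldsymbol\alpha=(\alpha_1,\dots,\alpha_k)$ with $0<\alpha_j<2$. Let $X\in\mathcal B^{\boldsymbol\alpha}_{\mathbf l}(\mathcal D,c(\cdot))$ be a locally stationary random field and let $I(X)=\int_{\mathcal D}X(\mathbf t)\,d\mathbf t$ be approximated by the stratified Monte Carlo quadrature $I_N(X,T_N)$, where $T_N$ is $cRS(h,\pi,\mathbf l)$, $h=(h_1,\dots,h_k)$. Let $$v_j:=\int_{\mathcal D}c_j(\mathbf t)\,b_{\alpha_j,l_j}(D_j(\mathbf t^j))\prod_{m=1}^d h_m^*(t_m)^{-1}\,d\mathbf t,\qquad D_j(\mathbf t^j):=\bigl(1/h_j(t_{L_{j-1}+1}),\dots,1/h_j(t_{L_j})\bigr)$$ (the constants in the asymptotics $\|I(X)-I_N(X,T_N)\|^2\sim N^{-1}\sum_{j=1}^k v_j n_j^{-\alpha_j}$). If for some $j$, $1\le j\le k$, $l_j=1$, then for any positive continuous density $h_j$ on $[0,1]$, $$v_j=a_{\alpha_j}\int_0^1 Q_j(t)\,h_j(t)^{-(1+\alpha_j)}\,dt .$$ The $j$-th withincomponent density minimizing $v_j$ is $$h_{j,opt}(t)=\frac{Q_j(t)^{\gamma_j}}{\int_0^1Q_j(\tau)^{\gamma_j}\,d\tau},\qquad t\in[0,1],\qquad \gamma_j:=\frac1{2+\alpha_j},$$ and for this density $$v_{j,opt}=a_{\alpha_j}\Bigl(\int_0^1Q_j(t)^{\gamma_j}\,dt\Bigr)^{1/\gamma_j}.$$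 Here $a_\beta:=\frac1{(1+\beta)(2+\beta)}$ for $0<\beta<2$, and $$Q_j(t_{L_j}):=\int_{[0,1]^{d-1}}c_j(\mathbf t)\prod_{\substack{m=1\\ m\ne L_j}}^d h_m^*(t_m)^{-1}\,dt_1\cdots dt_{L_j-1}\,dt_{L_j+1}\cdots dt_d,\qquad t_{L_j}\in[0,1].$$
   Context: Norms. For a square-integrable random variable $\xi$, $\|\xi\|=(\mathrm E\,\xi^2)^{1/2}$; for a vector, $\|\cdot\|$ is the Euclidean norm. $a_N\sim b_N$ means $a_N/b_N\to1$. The symbol $*$ between vectors denotes coordinatewise multiplication. Decomposition. $\mathbf l=(l_1,\dots,l_k)$, $k\le d$, is a vector of positive integers with $\sum_j l_j=d$; $L_0=0$, $L_i=\sum_{j\le i}l_j$. For $\mathbf s\in\mathbb R^d$, $\mathbf s^j=(s_{L_{j-1}+1},\dots,s_{L_j})$. Random fields. $X(\mathbf t)$, $\mathbf t\in\mathcal D=[0,1]^d$, is a random field with finite second moments, continuous in quadratic mean (and taken jointly measurable). $X\in\mathcal B^{\boldsymbol\alpha}_{\mathbf l}(\mathcal D,c(\cdot))$ (locally stationary) means $$\frac{\|X(\mathbf t+\mathbf s)-X(\mathbf t)\|^2}{\sum_{j=1}^k c_j(\mathbf t)\|\mathbf s^j\|^{\alpha_j}}\to1\quad\text{as }\mathbf s\to0,\text{ uniformly in }\mathbf t\in\mathcal D$$ (with $\mathbf t,\mathbf t+\mathbf s\in\mathcal D$), where $c_1,\dots,c_k$ are positive continuous functions on $\mathcal D$ and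 $c_j$ is invariant under permutations of the coordinates within the $j$-th component $\mathbf t^j$. Designs. $T_N$ is $cRS(h,\pi,\mathbf l)$ (cross regular sequence): $h=(h_1,\dots,h_k)$ are positive continuous probability densities on $[0,1]$ (withincomponent densities), $\pi(N)=(n_1(N),\dots,n_k(N))$ are positive integers; put $h_i^*=h_j$ and $n_i^*=n_j$ for $i=L_{j-1}+1,\dots,L_j$, $j=1,\dots,k$. It is required that $\prod_{i=1}^d n_i^*(N)=\prod_{j=1}^k n_j(N)^{l_j}=N$ and $n_j(N)\to\infty$ as $N\to\infty$ ($N$ ranging over an infinite set of positive integers for which such a factorization is available). The one-dimensional grid points are defined by $\int_0^{t_{m,i}}h_m^*(v)\,dv=i/n_m^*$, $i=0,\dots,n_m^*$, $m=1,\dots,d$, and $T_N$ is the product grid. It partitions $\mathcal D$ into the $N$ hyperrectangles (strata) $\mathcal D_{\mathbf i}=\prod_{m=1}^d[t_{m,i_m},t_{m,i_m+1}]$, $\mathbf i\in\mathbf I=\{(i_1,\dots,i_d):0\le i_m\le n_m^*-1\}$. Quadrature. $I_N(X,T_N)=\sum_{\mathbf i\in\mathbf I}X(\boldsymbol\eta_{\mathbf i})|\mathcal D_{\mathbf i}|$, where $|\mathcal D_{\mathbf i}|$ is the volume and $\boldsymbol\eta_{\mathbf i}$ is uniformly distributed on $\mathcal D_{\mathbf i}$; the $\boldsymbol\eta_{\mathbf i}$ are mutually independent and independent of $X$. Constant. For $0<\beta<2$, $m\in\mathbb N$, $\mathbf u\in\mathbb R_+^m$: $b_{\beta,m}(\mathbf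 u)=\frac12\int_{[0,1]^m}\int_{[0,1]^m}\|\mathbf u*(\mathbf t-\mathbf v)\|^\beta\,d\mathbf t\,d\mathbf v$. Minimization of $v_j$ is over positive continuous densities $h_j$ on $[0,1]$, with the other withincomponent densities fixed. *)

theory Defs
  imports "HOL-Probability.Probability"
begin

text \<open>
  A vector in R^m is a function on the index set {1..m}, extensional outside it, so that
  coordinates keep the usual numbering. Families indexed by the components of the decomposition
  (l, alpha, c, h, n) are functions on {1..k}. On an index set I, R^I carries the product topology
  and the product of the Borel-Lebesgue measures.
\<close>

definition leb :: "nat set \<Rightarrow> (nat \<Rightarrow> real) measure" where
  "leb I = Pi\<^sub>M I (\<lambda>_. lborel)"

definition cube :: "nat set \<Rightarrow> (nat \<Rightarrow> real) set" where
  "cube I = I \<rightarrow>\<^sub>E {0..1}"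

definition qm_norm :: "'w measure \<Rightarrow> ('w \<Rightarrow> real) \<Rightarrow> real" where
  "qm_norm M \<xi> = sqrt (\<integral>\<omega>. (\<xi> \<omega>)\<^sup>2 \<partial>M)"

definition decomposition :: "nat \<Rightarrow> nat \<Rightarrow> (nat \<Rightarrow> nat) \<Rightarrow> bool" where
  "decomposition d k l \<longleftrightarrow> (\<forall>j\<in>{1..k}. 0 < l j) \<and> (\<Sum>j=1..k. l j) = d"

definition L :: "(nat \<Rightarrow> nat) \<Rightarrow> nat \<Rightarrow> nat" where
  "L l i = (\<Sum>j=1..i. l j)"

definition block :: "(nat \<Rightarrow> nat) \<Rightarrow> (nat \<Rightarrow> real) \<Rightarrow> nat \<Rightarrow> nat \<Rightarrow> real" where
  "block l s j = (\<lambda>i\<in>{1..l j}. s (L l (j - 1) + i))"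

text \<open>The component containing coordinate i; the starred families are f (component_of l i).\<close>

definition component_of :: "(nat \<Rightarrow> nat) \<Rightarrow> nat \<Rightarrow> nat" where
  "component_of l i = (THE j. L l (j - 1) < i \<and> i \<le> L l j)"

definition qm_continuous_field ::
  "'w measure \<Rightarrow> nat \<Rightarrow> ((nat \<Rightarrow> real) \<Rightarrow> 'w \<Rightarrow> real) \<Rightarrow> bool" where
  "qm_continuous_field M d X \<longleftrightarrow>
     (\<lambda>(t, \<omega>). X t \<omega>) \<in> borel_measurable (restrict_space (leb {1..d}) (cube {1..d}) \<Otimes>\<^sub>M M) \<and>
     (\<forall>t\<in>cube {1..d}. X t \<in> borel_measurable M \<and> integrable M (\<lambda>\<omega>. (X t \<omega>)\<^sup>2)) \<and>
     (\<forall>t\<in>cube {1..d}.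
        ((\<lambda>s. qm_norm M (\<lambda>\<omega>. X s \<omega> - X t \<omega>)) \<longlongrightarrow> 0) (at t within cube {1..d}))"

definition local_coefficients ::
  "nat \<Rightarrow> nat \<Rightarrow> (nat \<Rightarrow> nat) \<Rightarrow> (nat \<Rightarrow> (nat \<Rightarrow> real) \<Rightarrow> real) \<Rightarrow> bool" where
  "local_coefficients d k l c \<longleftrightarrow>
     (\<forall>j\<in>{1..k}. continuous_on (cube {1..d}) (c j) \<and>
        (\<forall>t\<in>cube {1..d}. 0 < c j t) \<and>
        (\<forall>p. p permutes {L l (j - 1) + 1..L l j} \<longrightarrow>
           (\<forall>t\<in>cube {1..d}. c j (t \<circ> p) = c j t)))"

definition locally_stationary ::
  "'w measure \<Rightarrow> nat \<Rightarrow> nat \<Rightarrow> (nat \<Rightarrow> nat) \<Rightarrow> (nat \<Rightarrow> real) \<Rightarrow> (nat \<Rightarrow> (nat \<Rightarrow> real) \<Rightarrow> real) \<Rightarrow>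
   ((nat \<Rightarrow> real) \<Rightarrow> 'w \<Rightarrow> real) \<Rightarrow> bool" where
  "locally_stationary M d k l \<alpha> c X \<longleftrightarrow>
     qm_continuous_field M d X \<and> local_coefficients d k l c \<and>
     (\<forall>\<epsilon>>0. \<exists>\<delta>>0. \<forall>t\<in>cube {1..d}. \<forall>s.
        (\<lambda>i\<in>{1..d}. t i + s i) \<in> cube {1..d} \<and> 0 < L2_set s {1..d} \<and> L2_set s {1..d} < \<delta> \<longrightarrow>
        \<bar>(qm_norm M (\<lambda>\<omega>. X (\<lambda>i\<in>{1..d}. t i + s i) \<omega> - X t \<omega>))\<^sup>2 /
           (\<Sum>j=1..k. c j t * L2_set (block l s j) {1..l j} powr \<alpha> j) - 1\<bar> < \<epsilon>)"

definition pos_cont_density :: "(real \<Rightarrow> real) \<Rightarrow> bool" where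
  "pos_cont_density g \<longleftrightarrow>
     continuous_on {0..1} g \<and> (\<forall>x\<in>{0..1}. 0 < g x) \<and> (LINT x:{0..1}|lborel. g x) = 1"

text \<open>S is the infinite set over which N ranges; n j N is the number of intervals per
  coordinate of the j-th component.\<close>

definition cross_regular ::
  "nat \<Rightarrow> (nat \<Rightarrow> nat) \<Rightarrow> (nat \<Rightarrow> real \<Rightarrow> real) \<Rightarrow> (nat \<Rightarrow> nat \<Rightarrow> nat) \<Rightarrow> nat set \<Rightarrow> bool" where
  "cross_regular k l h n S \<longleftrightarrow>
     infinite S \<and>
     (\<forall>j\<in>{1..k}. pos_cont_density (h j)) \<and>
     (\<forall>N\<in>S. (\<forall>j\<in>{1..k}. 0 < n j N) \<and> (\<Prod>j=1..k. n j N ^ l j) = N) \<and>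
     (\<forall>j\<in>{1..k}. filterlim (n j) at_top (inf sequentially (principal S)))"

definition grid_point ::
  "(nat \<Rightarrow> nat) \<Rightarrow> (nat \<Rightarrow> real \<Rightarrow> real) \<Rightarrow> (nat \<Rightarrow> nat \<Rightarrow> nat) \<Rightarrow> nat \<Rightarrow> nat \<Rightarrow> nat \<Rightarrow> real" where
  "grid_point l h n N m i =
     (THE x. x \<in> {0..1} \<and> (LINT v:{0..x}|lborel. h (component_of l m) v) = real i / real (n (component_of l m) N))"

definition strata_index :: "nat \<Rightarrow> (nat \<Rightarrow> nat) \<Rightarrow> (nat \<Rightarrow> nat \<Rightarrow> nat) \<Rightarrow> nat \<Rightarrow> (nat \<Rightarrow> nat) set" where
  "strata_index d l n N = (\<Pi>\<^sub>E m\<in>{1..d}. {0..<n (component_of l m) N})"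

definition stratum ::
  "nat \<Rightarrow> (nat \<Rightarrow> nat) \<Rightarrow> (nat \<Rightarrow> real \<Rightarrow> real) \<Rightarrow> (nat \<Rightarrow> nat \<Rightarrow> nat) \<Rightarrow> nat \<Rightarrow> (nat \<Rightarrow> nat) \<Rightarrow>
   (nat \<Rightarrow> real) set" where
  "stratum d l h n N i =
     (\<Pi>\<^sub>E m\<in>{1..d}. {grid_point l h n N m (i m)..grid_point l h n N m (i m + 1)})"

definition field_integral :: "nat \<Rightarrow> ((nat \<Rightarrow> real) \<Rightarrow> 'w \<Rightarrow> real) \<Rightarrow> 'w \<Rightarrow> real" where
  "field_integral d X \<omega> = (LINT t:cube {1..d}|leb {1..d}. X t \<omega>)"

definition stratified_sample ::
  "'w measure \<Rightarrow> nat \<Rightarrow> (nat \<Rightarrow> nat) \<Rightarrow> (nat \<Rightarrow> real \<Rightarrow> real) \<Rightarrow> (nat \<Rightarrow> nat \<Rightarrow> nat) \<Rightarrow> nat \<Rightarrow>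
   ((nat \<Rightarrow> real) \<Rightarrow> 'w \<Rightarrow> real) \<Rightarrow> ((nat \<Rightarrow> nat) \<Rightarrow> 'w \<Rightarrow> nat \<Rightarrow> real) \<Rightarrow> bool" where
  "stratified_sample M d l h n N X \<eta> \<longleftrightarrow>
     (\<forall>i\<in>strata_index d l n N. \<eta> i \<in> measurable M (leb {1..d}) \<and>
        distr M (leb {1..d}) (\<eta> i) = uniform_measure (leb {1..d}) (stratum d l h n N i)) \<and>
     prob_space.indep_vars M (\<lambda>_. leb {1..d}) \<eta> (strata_index d l n N) \<and>
     prob_space.indep_set M
       (sets (vimage_algebra (space M) (\<lambda>\<omega>. \<lambda>t\<in>cube {1..d}. X t \<omega>)
          (Pi\<^sub>M (cube {1..d}) (\<lambda>_. borel))))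
       (sets (vimage_algebra (space M) (\<lambda>\<omega>. \<lambda>i\<in>strata_index d l n N. \<eta> i \<omega>)
          (Pi\<^sub>M (strata_index d l n N) (\<lambda>_. leb {1..d}))))"

definition stratified_quadrature ::
  "nat \<Rightarrow> (nat \<Rightarrow> nat) \<Rightarrow> (nat \<Rightarrow> real \<Rightarrow> real) \<Rightarrow> (nat \<Rightarrow> nat \<Rightarrow> nat) \<Rightarrow> nat \<Rightarrow>
   ((nat \<Rightarrow> real) \<Rightarrow> 'w \<Rightarrow> real) \<Rightarrow> ((nat \<Rightarrow> nat) \<Rightarrow> 'w \<Rightarrow> nat \<Rightarrow> real) \<Rightarrow> 'w \<Rightarrow> real" where
  "stratified_quadrature d l h n N X \<eta> \<omega> =
     (\<Sum>i\<in>strata_index d l n N. X (\<eta> i \<omega>) \<omega> * measure (leb {1..d}) (stratum d l h n N i))"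

definition b_const :: "real \<Rightarrow> nat \<Rightarrow> (nat \<Rightarrow> real) \<Rightarrow> real" where
  "b_const \<beta> m u = 1 / 2 *
     (LINT t:cube {1..m}|leb {1..m}. LINT v:cube {1..m}|leb {1..m}.
        L2_set (\<lambda>i. u i * (t i - v i)) {1..m} powr \<beta>)"

definition a_const :: "real \<Rightarrow> real" where
  "a_const \<beta> = 1 / ((1 + \<beta>) * (2 + \<beta>))"

definition v_const ::
  "nat \<Rightarrow> (nat \<Rightarrow> nat) \<Rightarrow> (nat \<Rightarrow> real) \<Rightarrow> (nat \<Rightarrow> (nat \<Rightarrow> real) \<Rightarrow> real) \<Rightarrow>
   (nat \<Rightarrow> real \<Rightarrow> real) \<Rightarrow> nat \<Rightarrow> real" where
  "v_const d l \<alpha> c h j =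
     (LINT t:cube {1..d}|leb {1..d}.
        c j t * b_const (\<alpha> j) (l j) (\<lambda>i\<in>{1..l j}. 1 / h j (block l t j i)) *
        (\<Prod>m=1..d. 1 / h (component_of l m) (t m)))"

definition Q_fun ::
  "nat \<Rightarrow> (nat \<Rightarrow> nat) \<Rightarrow> (nat \<Rightarrow> (nat \<Rightarrow> real) \<Rightarrow> real) \<Rightarrow> (nat \<Rightarrow> real \<Rightarrow> real) \<Rightarrow> nat \<Rightarrow> real \<Rightarrow> real" where
  "Q_fun d l c h j x =
     (LINT t:cube ({1..d} - {L l j})|leb ({1..d} - {L l j}).
        c j (t(L l j := x)) * (\<Prod>m\<in>{1..d} - {L l j}. 1 / h (component_of l m) (t m)))"

definition h_opt ::
  "nat \<Rightarrow> (nat \<Rightarrow> nat) \<Rightarrow> (nat \<Rightarrow> real) \<Rightarrow> (nat \<Rightarrow> (nat \<Rightarrow> real) \<Rightarrow> real) \<Rightarrow>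
   (nat \<Rightarrow> real \<Rightarrow> real) \<Rightarrow> nat \<Rightarrow> real \<Rightarrow> real" where
  "h_opt d l \<alpha> c h j t =
     Q_fun d l c h j t powr (1 / (2 + \<alpha> j)) /
     (LINT \<tau>:{0..1}|lborel. Q_fun d l c h j \<tau> powr (1 / (2 + \<alpha> j)))"

end

theory Submission
  imports Defs
begin

text \<open>
  If l j = 1, scaling reduces the constant b to the double integral of |x - y| to the power
  alpha j, which is 2 a(alpha j), and Fubini with the j-th component outermost gives
  v j = a(alpha j) times the integral of Q g^(-(1 + alpha j)). For the minimization put
  f = Q^gamma / A with A the integral of Q^gamma. Then Q = A^(2 + alpha j) f^(2 + alpha j), and
  the integral becomes A^(2 + alpha j) times the integral of g (f / g)^(2 + alpha j). The latter is
  at least 1 by Bernoulli's inequality, and equality forces f = g by continuity and strictness.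
\<close>

section \<open>Topology, measure and Fubini on the cube\<close>

text \<open>The type \<open>nat \<Rightarrow> real\<close> carries the product topology over all
  indices. Extensionality pins every coordinate outside \<open>I\<close> to
  \<open>undefined\<close>, so the cube is a full product of compact factors and Tychonoff's theorem
  applies.\<close>

lemma cube_PiE_UNIV: "cube I = (\<Pi>\<^sub>E i\<in>UNIV. if i \<in> I then {0..1} else {undefined})"
  by (auto simp: cube_def PiE_iff extensional_def split: if_splits)

lemma compact_cube: "compact (cube I)"
proof -
  have "compactin (product_topology (\<lambda>_. euclidean) UNIV) (cube I)"
    unfolding cube_PiE_UNIV compactin_PiE by auto
  then show ?thesis
    by (simp add: euclidean_product_topology)
qed

lemma cube_nonempty: "cube I \<noteq> {}"
  by (simp add: cube_def PiE_eq_empty_iff)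

lemma sets_cube: "finite I \<Longrightarrow> cube I \<in> sets (leb I)"
  unfolding cube_def leb_def by (intro sets_PiM_I_finite) auto

lemma emeasure_cube: "finite I \<Longrightarrow> emeasure (leb I) (cube I) = 1"
proof -
  interpret product_sigma_finite "\<lambda>_::nat. lborel :: real measure" by standard
  assume "finite I"
  then show ?thesis
    unfolding cube_def leb_def by (subst emeasure_PiM) auto
qed

text \<open>This links the Borel sets of the full function type with the finite product measure, so
  that continuous functions become measurable for \<open>leb I\<close>. Coordinates outside
  \<open>I\<close> are constant on the space of \<open>leb I\<close>.\<close>

lemma borel_measurable_leb_id: "(\<lambda>t. t) \<in> leb I \<rightarrow>\<^sub>M borel"
proof (rule measurable_coordinatewise_then_product)
  fix i
  show "(\<lambda>t. t i) \<in> borel_measurable (leb I)"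
  proof (cases "i \<in> I")
    case True
    then have "(\<lambda>t. t i) \<in> leb I \<rightarrow>\<^sub>M lborel"
      unfolding leb_def by (rule measurable_component_singleton)
    then show ?thesis by simp
  next
    case False
    then have "t i = undefined" if "t \<in> space (leb I)" for t
      using that by (auto simp: leb_def space_PiM PiE_def extensional_def)
    then show ?thesis
      by (subst measurable_cong[where g="\<lambda>_. undefined"]) auto
  qed
qed

text \<open>Compactness bounds \<open>f\<close> by a constant, and the cube has measure 1.\<close>

lemma set_integrable_continuous_on_cube:
  fixes f :: "(nat \<Rightarrow> real) \<Rightarrow> real"
  assumes "finite I" and f: "continuous_on (cube I) f"
  shows "set_integrable (leb I) (cube I) f"
proof -
  obtain B where B: "\<And>t. t \<in> cube I \<Longrightarrow> norm (f t) \<le> B"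
    using compact_imp_bounded[OF compact_continuous_image[OF f compact_cube]]
    by (auto simp: bounded_iff)
  have "cube I \<in> sets borel"
    by (simp add: borel_compact compact_cube)
  then have "(\<lambda>t. indicator (cube I) t *\<^sub>R f t) \<in> borel_measurable borel"
    using f by (rule borel_measurable_continuous_on_indicator)
  from measurable_compose[OF borel_measurable_leb_id this]
  have m: "(\<lambda>t. indicator (cube I) t *\<^sub>R f t) \<in> borel_measurable (leb I)" .
  show ?thesis
    unfolding set_integrable_def
  proof (rule Bochner_Integration.integrable_bound[OF _ m])
    show "integrable (leb I) (\<lambda>t. indicator (cube I) t * B)"
      using sets_cube[OF \<open>finite I\<close>] emeasure_cube[OF \<open>finite I\<close>]
      by (intro integrable_mult_left) simp
    show "AE t in leb I. norm (indicator (cube I) t *\<^sub>R f t) \<le> norm (indicator (cube I) t * B)"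
      by (auto split: split_indicator simp: abs_real_def dest!: B)
  qed
qed

lemma cube_fun_upd: "t \<in> cube I \<Longrightarrow> x \<in> {0..1} \<Longrightarrow> t(i := x) \<in> cube (insert i I)"
  by (auto simp: cube_def PiE_iff extensional_def)

lemma continuous_on_fun_upd_const: "continuous_on A (\<lambda>t. t(i := x))"
  for A :: "('a \<Rightarrow> 'b::topological_space) set"
proof (rule continuous_on_coordinatewise_then_product)
  fix j show "continuous_on A (\<lambda>t. (t(i := x)) j)"
    by (cases "j = i") (auto intro: continuous_on_product_then_coordinatewise continuous_on_id)
qed

lemma continuous_on_fun_upd_value: "continuous_on A (\<lambda>x. t(i := x))"
  for A :: "'b::topological_space set"
proof (rule continuous_on_coordinatewise_then_product)
  fix j show "continuous_on A (\<lambda>x. (t(i := x)) j)"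
    by (cases "j = i") (auto intro: continuous_on_id)
qed

lemma continuous_on_cube_section:
  assumes f: "continuous_on (cube (insert i I)) f" and "x \<in> {0..1}"
  shows "continuous_on (cube I) (\<lambda>t. f (t(i := x)))"
  by (rule continuous_on_compose2[OF f continuous_on_fun_upd_const])
     (use assms cube_fun_upd in auto)

text \<open>Dominated convergence along sequences: the bound of \<open>f\<close> on the larger
  compact cube serves as a dominating constant for all sections at once.\<close>

lemma continuous_on_cube_integral:
  fixes f :: "(nat \<Rightarrow> real) \<Rightarrow> real"
  assumes "finite I" and f: "continuous_on (cube (insert i I)) f"
  shows "continuous_on {0..1} (\<lambda>x. LINT t:cube I|leb I. f (t(i := x)))"
  unfolding continuous_on_sequentially comp_def
proof (intro allI ballI impI, elim conjE)
  fix u and x :: real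
  assume x: "x \<in> {0..1}" and u: "\<forall>n. u n \<in> {0..1}" and lim: "u \<longlonglongrightarrow> x"
  obtain B where B: "\<And>t. t \<in> cube (insert i I) \<Longrightarrow> norm (f t) \<le> B"
    using compact_imp_bounded[OF compact_continuous_image[OF f compact_cube]]
    by (auto simp: bounded_iff)
  have int: "integrable (leb I) (\<lambda>t. indicator (cube I) t *\<^sub>R f (t(i := y)))" if "y \<in> {0..1}" for y
    using set_integrable_continuous_on_cube[OF \<open>finite I\<close> continuous_on_cube_section[OF f that]]
    by (simp add: set_integrable_def)
  show "(\<lambda>n. LINT t:cube I|leb I. f (t(i := u n))) \<longlonglongrightarrow> (LINT t:cube I|leb I. f (t(i := x)))"
    unfolding set_lebesgue_integral_def
  proof (rule integral_dominated_convergence)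
    show "integrable (leb I) (\<lambda>t. indicator (cube I) t * B)"
      using sets_cube[OF \<open>finite I\<close>] emeasure_cube[OF \<open>finite I\<close>]
      by (intro integrable_mult_left) simp
    show "AE t in leb I. norm (indicator (cube I) t *\<^sub>R f (t(i := u n))) \<le> indicator (cube I) t * B" for n
      using B cube_fun_upd u by (auto split: split_indicator)
    show "AE t in leb I. (\<lambda>n. indicator (cube I) t *\<^sub>R f (t(i := u n)))
        \<longlonglongrightarrow> indicator (cube I) t *\<^sub>R f (t(i := x))"
    proof (rule AE_I2)
      fix t
      show "(\<lambda>n. indicator (cube I) t *\<^sub>R f (t(i := u n))) \<longlonglongrightarrow> indicator (cube I) t *\<^sub>R f (t(i := x))"
      proof (cases "t \<in> cube I")
        case True
        have "continuous_on {0..1} (\<lambda>y. f (t(i := y)))"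
          by (rule continuous_on_compose2[OF f continuous_on_fun_upd_value])
             (use True cube_fun_upd in auto)
        then have "(\<lambda>n. f (t(i := u n))) \<longlonglongrightarrow> f (t(i := x))"
          using x u lim unfolding continuous_on_sequentially comp_def by blast
        with True show ?thesis by simp
      qed simp
    qed
  qed (use int x u in \<open>auto dest: borel_measurable_integrable\<close>)
qed

text \<open>Fubini's theorem with coordinate \<open>i\<close> outermost. It is what isolates the
  coordinate of a one-dimensional component.\<close>

lemma integral_cube_insert:
  fixes f :: "(nat \<Rightarrow> real) \<Rightarrow> real"
  assumes "finite I" "i \<notin> I" and f: "continuous_on (cube (insert i I)) f"
  shows "(LINT t:cube (insert i I)|leb (insert i I). f t) =
    (LINT x:{0..1}|lborel. LINT t:cube I|leb I. f (t(i := x)))"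
proof -
  interpret product_sigma_finite "\<lambda>_::nat. lborel :: real measure" by standard
  let ?F = "\<lambda>t. indicator (cube (insert i I)) t *\<^sub>R f t"
  have int: "integrable (Pi\<^sub>M ({i} \<union> I) (\<lambda>_. lborel)) ?F"
    using set_integrable_continuous_on_cube[OF _ f] \<open>finite I\<close>
    by (simp add: set_integrable_def leb_def)
  \<comment> \<open>Since \<open>i\<close> lies outside \<open>I\<close>, updating there leaves the
    other coordinates alone, and the indicator factorizes.\<close>
  have ind: "indicator (cube (insert i I)) (t(i := x)) = (indicator {0..1} x * indicator (cube I) t :: real)"
    if "t \<in> space (leb I)" for t x
    using that \<open>i \<notin> I\<close>
    by (auto simp: cube_def leb_def space_PiM PiE_iff extensional_def split: split_indicator)
  \<comment> \<open>The section is a continuous function of x cut off to the unit interval, which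
    later gives its measurability.\<close>
  have sect: "(LINT t|Pi\<^sub>M I (\<lambda>_. lborel). ?F (t(i := x))) =
      indicator {0..1} x *\<^sub>R (LINT t:cube I|leb I. f (t(i := x)))" for x
    unfolding set_lebesgue_integral_def integral_scaleR_right[symmetric] leb_def
    by (intro Bochner_Integration.integral_cong) (auto simp: ind leb_def)
  have "(LINT t:cube (insert i I)|leb (insert i I). f t) = integral\<^sup>L (Pi\<^sub>M ({i} \<union> I) (\<lambda>_. lborel)) ?F"
    by (simp add: set_lebesgue_integral_def leb_def)
  also have "\<dots> = (LINT x|Pi\<^sub>M {i} (\<lambda>_. lborel). LINT t|Pi\<^sub>M I (\<lambda>_. lborel). ?F (merge {i} I (x, t)))"
    using assms int by (intro product_integral_fold) auto
  also have "\<dots> = (LINT x|Pi\<^sub>M {i} (\<lambda>_. lborel). LINT t|Pi\<^sub>M I (\<lambda>_. lborel). ?F (t(i := x i)))"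
  proof (intro Bochner_Integration.integral_cong refl)
    fix x t assume "x \<in> space (Pi\<^sub>M {i} (\<lambda>_. lborel :: real measure))" "t \<in> space (Pi\<^sub>M I (\<lambda>_. lborel :: real measure))"
    then have "merge {i} I (x, t) = t(i := x i)"
      using \<open>i \<notin> I\<close> by (auto simp: merge_def space_PiM PiE_iff extensional_def fun_eq_iff)
    then show "?F (merge {i} I (x, t)) = ?F (t(i := x i))" by simp
  qed
  also have "\<dots> = (LINT x|lborel. LINT t|Pi\<^sub>M I (\<lambda>_. lborel). ?F (t(i := x)))"
  proof (rule product_integral_singleton)
    show "(\<lambda>x. LINT t|Pi\<^sub>M I (\<lambda>_. lborel). ?F (t(i := x))) \<in> borel_measurable lborel"
      unfolding sect using continuous_on_cube_integral[OF \<open>finite I\<close> f]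
      using borel_measurable_continuous_on_indicator[of "{0..1}" "\<lambda>x. LINT t:cube I|leb I. f (t(i := x))"]
      by simp
  qed
  also have "\<dots> = (LINT x:{0..1}|lborel. LINT t:cube I|leb I. f (t(i := x)))"
    unfolding sect set_lebesgue_integral_def ..
  finally show ?thesis .
qed

text \<open>By compactness \<open>f\<close> attains a minimum, which is positive and bounds the
  integral from below because the cube has measure 1.\<close>

lemma integral_cube_pos:
  fixes f :: "(nat \<Rightarrow> real) \<Rightarrow> real"
  assumes "finite I" and f: "continuous_on (cube I) f" and pos: "\<And>t. t \<in> cube I \<Longrightarrow> 0 < f t"
  shows "0 < (LINT t:cube I|leb I. f t)"
proof -
  obtain s where s: "s \<in> cube I" "\<And>t. t \<in> cube I \<Longrightarrow> f s \<le> f t"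
    using continuous_attains_inf[OF compact_cube cube_nonempty f] by blast
  have "(LINT t:cube I|leb I. f s) \<le> (LINT t:cube I|leb I. f t)"
    using s set_integrable_continuous_on_cube[OF \<open>finite I\<close>] f
    by (intro set_integral_mono) auto
  moreover have "(LINT t:cube I|leb I. f s) = f s"
    using sets_cube[OF \<open>finite I\<close>] emeasure_cube[OF \<open>finite I\<close>]
    by (simp add: set_integral_const measure_def)
  ultimately show ?thesis using pos[OF s(1)] by linarith
qed

text \<open>The first rule asks for a nonzero base, which fails at the endpoints of the unit interval.\<close>

declare continuous_on_powr [continuous_intros del] continuous_on_powr' [continuous_intros]

section \<open>One-dimensional integrals and the constant b\<close>

text \<open>The finite exceptional set \<open>S\<close> absorbs the kink of |x - y| and the
  endpoints at which a power has base zero.\<close>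

lemma set_integral_Icc_antiderivative:
  fixes f F :: "real \<Rightarrow> real"
  assumes "a \<le> b" "finite S" and F: "continuous_on {a..b} F" and f: "continuous_on {a..b} f"
    and "\<And>x. x \<in> {a..b} - S \<Longrightarrow> (F has_real_derivative f x) (at x)"
  shows "(LINT x:{a..b}|lborel. f x) = F b - F a"
proof -
  have "(f has_integral (F b - F a)) {a..b}"
    using assms by (intro fundamental_theorem_of_calculus_strong[of S])
      (auto simp: has_real_derivative_iff_has_vector_derivative)
  then show ?thesis
    using set_borel_integral_eq_integral(2)[OF borel_integrable_atLeastAtMost'[OF f]]
    by (simp add: integral_unique)
qed

lemma integral_abs_diff_powr:
  fixes \<beta> :: real
  assumes "0 < \<beta>" "x \<in> {0..1}"
  shows "(LINT y:{0..1}|lborel. \<bar>x - y\<bar> powr \<beta>) =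
    (x powr (\<beta> + 1) + (1 - x) powr (\<beta> + 1)) / (\<beta> + 1)"
proof -
  \<comment> \<open>The sign of y - x merges the antiderivatives on the two sides of x into one
    expression that is continuous across x.\<close>
  let ?F = "\<lambda>y. (y - x) * \<bar>x - y\<bar> powr \<beta> / (\<beta> + 1)"
  have "(LINT y:{0..1}|lborel. \<bar>x - y\<bar> powr \<beta>) = ?F 1 - ?F 0"
  proof (rule set_integral_Icc_antiderivative[where S="{x}"])
    fix y assume "y \<in> {0..1} - {x}"
    then consider "y < x" | "x < y" by fastforce
    then show "(?F has_real_derivative \<bar>x - y\<bar> powr \<beta>) (at y)"
    proof cases
      case 1
      have "((\<lambda>y. - ((x - y) powr (\<beta> + 1) / (\<beta> + 1))) has_real_derivative (x - y) powr \<beta>) (at y)"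
        using 1 assms by (auto intro!: derivative_eq_intros)
      moreover have "\<forall>\<^sub>F z in nhds y. z < x"
        using 1 by (rule eventually_nhds_in_open[of "{..<x}", simplified])
      then have "\<forall>\<^sub>F z in nhds y. - ((x - z) powr (\<beta> + 1) / (\<beta> + 1)) = ?F z"
        by eventually_elim (use assms in \<open>auto simp: powr_add field_simps\<close>)
      ultimately show ?thesis using 1 by (subst (asm) DERIV_cong_ev) auto
    next
      case 2
      have "((\<lambda>y. (y - x) powr (\<beta> + 1) / (\<beta> + 1)) has_real_derivative (y - x) powr \<beta>) (at y)"
        using 2 assms by (auto intro!: derivative_eq_intros)
      moreover have "\<forall>\<^sub>F z in nhds y. x < z"
        using 2 by (rule eventually_nhds_in_open[of "{x<..}", simplified])
      then have "\<forall>\<^sub>F z in nhds y. (z - x) powr (\<beta> + 1) / (\<beta> + 1) = ?F z"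
        by eventually_elim (use assms in \<open>auto simp: powr_add field_simps\<close>)
      ultimately show ?thesis using 2 by (subst (asm) DERIV_cong_ev) auto
    qed
  qed (use assms in \<open>auto intro!: continuous_intros\<close>)
  also have "\<dots> = (x powr (\<beta> + 1) + (1 - x) powr (\<beta> + 1)) / (\<beta> + 1)"
    using assms by (simp add: powr_add flip: add_divide_distrib)
  finally show ?thesis .
qed

lemma integral_powr_sum:
  fixes \<beta> :: real
  assumes "0 < \<beta>"
  shows "(LINT x:{0..1}|lborel. (x powr (\<beta> + 1) + (1 - x) powr (\<beta> + 1)) / (\<beta> + 1)) = 2 * a_const \<beta>"
proof -
  let ?F = "\<lambda>x. (x powr (\<beta> + 2) - (1 - x) powr (\<beta> + 2)) / ((\<beta> + 1) * (\<beta> + 2))"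
  have "(LINT x:{0..1}|lborel. (x powr (\<beta> + 1) + (1 - x) powr (\<beta> + 1)) / (\<beta> + 1)) = ?F 1 - ?F 0"
  proof (rule set_integral_Icc_antiderivative[where S="{0, 1}"])
    fix x :: real assume "x \<in> {0..1} - {0, 1}"
    then have x: "0 < x" "x < 1" by auto
    have eq: "((\<beta> + 2) * A + (\<beta> + 2) * B) / ((\<beta> + 1) * (\<beta> + 2)) = (A + B) / (\<beta> + 1)" for A B
      using assms by (simp add: divide_simps) (simp add: algebra_simps)
    have "(?F has_real_derivative ((\<beta> + 2) * x powr (\<beta> + 1) + (\<beta> + 2) * (1 - x) powr (\<beta> + 1))
        / ((\<beta> + 1) * (\<beta> + 2))) (at x)"
      using x assms by (auto intro!: derivative_eq_intros simp: add.commute)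
    then show "(?F has_real_derivative (x powr (\<beta> + 1) + (1 - x) powr (\<beta> + 1)) / (\<beta> + 1)) (at x)"
      unfolding eq .
  qed (use assms in \<open>auto intro!: continuous_intros\<close>)
  also have "\<dots> = 2 * a_const \<beta>"
    using assms by (simp add: a_const_def field_simps)
  finally show ?thesis .
qed

text \<open>Identifies functions on a one-point index set with real numbers.\<close>

lemma integral_cube_singleton:
  fixes f :: "real \<Rightarrow> real"
  assumes "(\<lambda>x. indicator {0..1} x *\<^sub>R f x) \<in> borel_measurable borel"
  shows "(LINT t:cube {i}|leb {i}. f (t i)) = (LINT x:{0..1}|lborel. f x)"
proof -
  interpret product_sigma_finite "\<lambda>_::nat. lborel :: real measure" by standard
  have "(LINT t:cube {i}|leb {i}. f (t i)) =
      (LINT t|Pi\<^sub>M {i} (\<lambda>_. lborel). indicator {0..1} (t i) *\<^sub>R f (t i))"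
    unfolding set_lebesgue_integral_def leb_def
    by (intro Bochner_Integration.integral_cong)
       (auto simp: cube_def space_PiM PiE_iff split: split_indicator)
  also have "\<dots> = (LINT x:{0..1}|lborel. f x)"
    unfolding set_lebesgue_integral_def using assms by (intro product_integral_singleton) simp
  finally show ?thesis .
qed

text \<open>In dimension one the Euclidean norm is the absolute value, so the scale factor leaves
  the integral; the 1/2 in \<open>b_const\<close> cancels the 2 in
  \<open>integral_powr_sum\<close>.\<close>

lemma b_const_one:
  assumes "0 < \<beta>"
  shows "b_const \<beta> 1 u = a_const \<beta> * \<bar>u 1\<bar> powr \<beta>"
proof -
  let ?g = "\<lambda>x. (x powr (\<beta> + 1) + (1 - x) powr (\<beta> + 1)) / (\<beta> + 1)"
  have inner: "(LINT v:cube {1}|leb {1}. \<bar>u 1 * (t 1 - v 1)\<bar> powr \<beta>) = \<bar>u 1\<bar> powr \<beta> * ?g (t 1)"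
    if "t \<in> cube {1}" for t
  proof -
    have "t 1 \<in> {0..1}" using that by (auto simp: cube_def PiE_iff)
    have "(LINT v:cube {1}|leb {1}. \<bar>u 1 * (t 1 - v 1)\<bar> powr \<beta>) =
        (LINT x:{0..1}|lborel. \<bar>u 1 * (t 1 - x)\<bar> powr \<beta>)"
      using assms by (intro integral_cube_singleton borel_measurable_continuous_on_indicator)
        (auto intro!: continuous_intros)
    also have "\<dots> = \<bar>u 1\<bar> powr \<beta> * (LINT x:{0..1}|lborel. \<bar>t 1 - x\<bar> powr \<beta>)"
      by (simp add: abs_mult powr_mult)
    also have "\<dots> = \<bar>u 1\<bar> powr \<beta> * ?g (t 1)"
      using integral_abs_diff_powr[OF assms \<open>t 1 \<in> {0..1}\<close>] by simp
    finally show ?thesis .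
  qed
  have "b_const \<beta> 1 u = 1 / 2 * (LINT t:cube {1}|leb {1}. LINT v:cube {1}|leb {1}. \<bar>u 1 * (t 1 - v 1)\<bar> powr \<beta>)"
    by (simp add: b_const_def)
  also have "\<dots> = 1 / 2 * (LINT t:cube {1}|leb {1}. \<bar>u 1\<bar> powr \<beta> * ?g (t 1))"
    \<comment> \<open>The evaluation \<open>inner\<close> is available only on the cube; unfolding
      exposes the indicator, which supplies the membership.\<close>
    unfolding set_lebesgue_integral_def
    by (intro arg_cong[where f="(*) (1/2)"] Bochner_Integration.integral_cong refl)
       (use inner in \<open>auto simp: set_lebesgue_integral_def split: split_indicator\<close>)
  also have "\<dots> = 1 / 2 * (LINT x:{0..1}|lborel. \<bar>u 1\<bar> powr \<beta> * ?g x)"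
    using assms by (subst integral_cube_singleton[where f="\<lambda>x. \<bar>u 1\<bar> powr \<beta> * ?g x"])
      (auto intro!: borel_measurable_continuous_on_indicator continuous_intros)
  also have "\<dots> = a_const \<beta> * \<bar>u 1\<bar> powr \<beta>"
    unfolding set_integral_mult_right integral_powr_sum[OF assms] by simp
  finally show ?thesis .
qed

section \<open>Tangent inequalities and minimization over densities\<close>

text \<open>A convex function lies above its tangent, here taken at 1.\<close>

lemma powr_tangent_le:
  fixes x q :: real
  assumes "0 < x" "1 \<le> q"
  shows "1 + q * (x - 1) \<le> x powr q"
proof -
  have "q * (x - 1) \<le> x powr q - 1 powr q"
    using assms
    by (intro convex_on_imp_above_tangent[OF powr_convex[OF \<open>1 \<le> q\<close>]])
       (auto intro!: derivative_eq_intros simp: interior_open)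
  then show ?thesis by simp
qed

text \<open>Strictness comes from halving the exponent: with y = x^(p/2) different from 1, y^2 > 2y
  - 1, and the weak inequality for p/2 bounds y from below.\<close>

lemma powr_tangent_less:
  fixes x p :: real
  assumes "0 < x" "2 < p" "x \<noteq> 1"
  shows "1 + p * (x - 1) < x powr p"
proof -
  define y where "y = x powr (p / 2)"
  have "y \<noteq> 1" using assms powr_eq_one_iff_gen[of x "p/2"] by (auto simp: y_def)
  then have "0 < (y - 1)\<^sup>2" by simp
  then have "2 * y - 1 < y\<^sup>2" by (simp add: power2_eq_square algebra_simps)
  also have "y\<^sup>2 = x powr p"
    by (simp add: y_def power2_eq_square flip: powr_add)
  finally show ?thesis
    using powr_tangent_le[of x "p / 2"] assms by (simp add: y_def)
qed

text \<open>
  Integrating the tangent inequality at 1 for the power 2 + a of f / g against g: both densities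
  have integral 1, so the linear part contributes exactly 1.
\<close>

lemma density_ratio_integral_ge:
  fixes f g :: "real \<Rightarrow> real"
  assumes f: "pos_cont_density f" and g: "pos_cont_density g" and "0 < a"
  defines "W \<equiv> LINT t:{0..1}|lborel. f t powr (2 + a) * g t powr (-(1 + a))"
  shows "1 \<le> W" and "W = 1 \<Longrightarrow> t \<in> {0..1} \<Longrightarrow> g t = f t"
proof -
  have cont: "continuous_on {0..1} f" "continuous_on {0..1} g"
    and pos: "\<And>t. t \<in> {0..1} \<Longrightarrow> 0 < f t \<and> 0 < g t"
    and int1: "(LINT t:{0..1}|lborel. f t) = 1" "(LINT t:{0..1}|lborel. g t) = 1"
    using f g by (auto simp: pos_cont_density_def)
  let ?w = "\<lambda>t. f t powr (2 + a) * g t powr (-(1 + a))"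
  \<comment> \<open>The subtracted linear part has integral (2 + a) - (1 + a) = 1, so
    \<open>?D\<close> integrates to W - 1.\<close>
  let ?D = "\<lambda>t. ?w t - ((2 + a) * f t - (1 + a) * g t)"
  have w: "?w t = g t * (f t / g t) powr (2 + a)" if "t \<in> {0..1}" for t
  proof -
    have "g t powr (-(1 + a)) = g t powr (1 + -(2 + a))" by (rule arg_cong) simp
    also have "\<dots> = g t * g t powr (-(2 + a))"
      using pos[OF that] unfolding powr_add by simp
    finally show ?thesis
      using pos[OF that] powr_divide[of "f t" "g t" "2 + a"] 
      by (simp only: powr_minus[of "g t" "2 + a"]) (simp add: divide_inverse)
  qed
  \<comment> \<open>Factoring out \<open>g\<close> exhibits \<open>?D\<close> as the gap between the
    power and its tangent at the ratio f / g.\<close>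
  have D: "?D t = g t * ((f t / g t) powr (2 + a) - (1 + (2 + a) * (f t / g t - 1)))" if "t \<in> {0..1}" for t
    using pos[OF that] unfolding w[OF that] by (simp add: field_simps)
  have D0: "0 \<le> ?D t" if "t \<in> {0..1}" for t
    unfolding D[OF that] using pos[OF that] powr_tangent_le[of "f t / g t" "2 + a"] \<open>0 < a\<close> by simp
  have contw: "continuous_on {0..1} ?w" 
    using pos by (intro continuous_on_mult continuous_on_powr cont continuous_on_const) force+
  have contD: "continuous_on {0..1} ?D"
    by (intro continuous_on_diff continuous_on_mult contw cont continuous_on_const)
  have int: "set_integrable lborel {0..1} ?w" "set_integrable lborel {0..1} f" "set_integrable lborel {0..1} g"
    using contw cont by (auto intro: borel_integrable_atLeastAtMost')
  have W: "W - 1 = (LINT t:{0..1}|lborel. ?D t)"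
    using int by (simp add: W_def set_integral_diff int1)
  also have "\<dots> = integral {0..1} ?D"
    using contD by (intro set_borel_integral_eq_integral borel_integrable_atLeastAtMost')
  finally have WD: "W - 1 = integral {0..1} ?D" .
  show "1 \<le> W"
    using WD D0 by (smt (verit) integral_nonneg integrable_continuous_real[OF contD])
  show "g t = f t" if "W = 1" "t \<in> {0..1}"
  proof -
    \<comment> \<open>A continuous nonnegative function with integral zero vanishes at every point,
      not merely almost everywhere.\<close>
    have "?D t = 0"
      using integral_eq_0_iff[OF contD] D0 WD that by simp
    then have "(f t / g t) powr (2 + a) = 1 + (2 + a) * (f t / g t - 1)"
      using pos[OF that(2)] unfolding D[OF that(2)] by simp
    then have "f t / g t = 1"
      using powr_tangent_less[of "f t / g t" "2 + a"] pos[OF that(2)] \<open>0 < a\<close> by fastforce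
    then show ?thesis using pos[OF that(2)] by simp
  qed
qed

text \<open>Being a density constrains only the values on the unit interval, so minimizers can be
  characterized only by agreement there.\<close>

lemma pos_cont_density_cong:
  assumes "pos_cont_density f" "\<And>t. t \<in> {0..1} \<Longrightarrow> g t = f t"
  shows "pos_cont_density g"
proof -
  have "continuous_on {0..1} g \<longleftrightarrow> continuous_on {0..1} f"
    using assms(2) by (intro continuous_on_cong) auto
  moreover have "(LINT x:{0..1}|lborel. g x) = (LINT x:{0..1}|lborel. f x)"
    using assms(2) by (intro set_lebesgue_integral_cong) auto
  ultimately show ?thesis using assms by (auto simp: pos_cont_density_def)
qed

text \<open>The variational problem for an arbitrary positive continuous weight \<open>q\<close>, to
  be applied to \<open>Q_fun\<close>. The last claim is uniqueness of the minimizer.\<close>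

lemma powr_density_minimization:
  fixes q f :: "real \<Rightarrow> real"
  assumes q: "continuous_on {0..1} q" "\<forall>t\<in>{0..1}. 0 < q t" and "0 < a"
    and f_def: "f = (\<lambda>t. q t powr (1 / (2 + a)) / (LINT t:{0..1}|lborel. q t powr (1 / (2 + a))))"
  defines "A \<equiv> LINT t:{0..1}|lborel. q t powr (1 / (2 + a))"
  defines "J \<equiv> \<lambda>g. LINT t:{0..1}|lborel. q t * g t powr (-(1 + a))"
  shows "pos_cont_density f" and "J f = A powr (2 + a)"
    and "pos_cont_density g \<Longrightarrow> J f \<le> J g"
    and "pos_cont_density g \<Longrightarrow> J g = J f \<Longrightarrow> t \<in> {0..1} \<Longrightarrow> g t = f t"
proof -
  note f_def = f_def[folded A_def]
  have cont: "continuous_on {0..1} (\<lambda>t. q t powr (1 / (2 + a)))"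
    using q by (intro continuous_intros) (auto simp: less_eq_real_def)
  have "A = integral {0..1} (\<lambda>t. q t powr (1 / (2 + a)))"
    unfolding A_def using cont by (intro set_borel_integral_eq_integral borel_integrable_atLeastAtMost')
  moreover have "0 \<le> integral {0..1} (\<lambda>t. q t powr (1 / (2 + a)))"
    using cont by (intro integral_nonneg integrable_continuous_real) auto
  \<comment> \<open>A single nonzero value suffices: a nonnegative continuous integrand with
    integral zero would vanish everywhere.\<close>
  moreover have "q 0 powr (1 / (2 + a)) \<noteq> 0"
    using q(2) by force
  then have "integral {0..1} (\<lambda>t. q t powr (1 / (2 + a))) \<noteq> 0"
    using integral_eq_0_iff[OF cont] by auto
  ultimately have "0 < A" by simp
  have fpos: "0 < f t" if "t \<in> {0..1}" for t
    using bspec[OF q(2) that] \<open>0 < A\<close> by (simp add: f_def)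
  have "continuous_on {0..1} f"
    unfolding f_def using \<open>0 < A\<close> by (intro continuous_on_divide cont continuous_on_const) auto
  moreover have int1: "(LINT t:{0..1}|lborel. f t) = 1"
    using \<open>0 < A\<close> by (simp add: f_def A_def[symmetric])
  ultimately show dens: "pos_cont_density f"
    using fpos by (simp add: pos_cont_density_def)
  \<comment> \<open>Raising the definition of \<open>f\<close> to the power 2 + a undoes the
    exponent 1 / (2 + a).\<close>
  have qf: "q t = A powr (2 + a) * f t powr (2 + a)" if "t \<in> {0..1}" for t
    using bspec[OF q(2) that] \<open>0 < A\<close> \<open>0 < a\<close> by (simp add: f_def powr_divide powr_powr)
  have J: "J g = A powr (2 + a) * (LINT t:{0..1}|lborel. f t powr (2 + a) * g t powr (-(1 + a)))" for g
  proof -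
    have "J g = (LINT t:{0..1}|lborel. A powr (2 + a) * (f t powr (2 + a) * g t powr (-(1 + a))))"
      unfolding J_def by (intro set_lebesgue_integral_cong) (simp_all add: qf)
    then show ?thesis by simp
  qed
  \<comment> \<open>The exponents add up to 1, so the bound 1 on the ratio integral is attained at
    \<open>f\<close>.\<close>
  have "(LINT t:{0..1}|lborel. f t powr (2 + a) * f t powr (-(1 + a))) = (LINT t:{0..1}|lborel. f t)"
    using fpos by (intro set_lebesgue_integral_cong) (auto simp: abs_of_pos simp flip: powr_add)
  then show Jf: "J f = A powr (2 + a)"
    by (simp add: J int1)
  show "J f \<le> J g" if "pos_cont_density g"
    unfolding Jf J[of g]
    using mult_left_mono[OF density_ratio_integral_ge(1)[OF dens that \<open>0 < a\<close>], of "A powr (2 + a)"] by simp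
  show "g t = f t" if "pos_cont_density g" "J g = J f" "t \<in> {0..1}"
    using density_ratio_integral_ge(2)[OF dens that(1) \<open>0 < a\<close> _ that(3)] that(2) \<open>0 < A\<close>
    unfolding Jf J[of g] by simp
qed

section \<open>Components of the decomposition and reduction of v to one coordinate\<close>

lemma L_mono: "i \<le> j \<Longrightarrow> L l i \<le> L l j"
  unfolding L_def by (intro sum_mono2) auto

text \<open>Monotone partial sums make the index intervals of distinct components disjoint, so the
  definite description is unique.\<close>

lemma component_of_eq:
  assumes "L l (j - 1) < i" "i \<le> L l j"
  shows "component_of l i = j"
  unfolding component_of_def
proof (rule the_equality)
  fix j' assume j': "L l (j' - 1) < i \<and> i \<le> L l j'"
  show "j' = j"
  proof (rule ccontr)
    assume "j' \<noteq> j"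
    then have "j \<le> j' - 1 \<or> j' \<le> j - 1" by linarith
    then show False
      using L_mono[of j "j' - 1" l] L_mono[of j' "j - 1" l] assms j' by linarith
  qed
qed (use assms in simp)

text \<open>The component of \<open>i\<close> is the least index whose partial sum reaches
  \<open>i\<close>; leastness yields the strict lower bound.\<close>

lemma component_of_bounds:
  assumes "decomposition d k l" "i \<in> {1..d}"
  shows "component_of l i \<in> {1..k}" "L l (component_of l i - 1) < i" "i \<le> L l (component_of l i)"
proof -
  define j where "j = (LEAST j. i \<le> L l j)"
  have "i \<le> L l k" using assms by (simp add: decomposition_def L_def)
  then have j: "i \<le> L l j" "j \<le> k"
    unfolding j_def by (rule LeastI, rule Least_le)
  \<comment> \<open>The empty partial sum is 0, below \<open>i\<close>. Hence j - 1 is a genuine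
    predecessor and not a truncated difference.\<close>
  have "j \<noteq> 0" using j(1) assms(2) by (cases j) (auto simp: L_def)
  then have "L l (j - 1) < i"
    using not_less_Least[of "j - 1" "\<lambda>j. i \<le> L l j"] by (simp add: j_def[symmetric])
  with j \<open>j \<noteq> 0\<close> show "component_of l i \<in> {1..k}" "L l (component_of l i - 1) < i"
    "i \<le> L l (component_of l i)"
    by (auto simp: component_of_eq)
qed

text \<open>
  Throughout, the one-dimensional component j occupies the single coordinate p, so that the
  product of the remaining reciprocal densities does not involve h j.
\<close>

context
  fixes d k :: nat and l :: "nat \<Rightarrow> nat" and \<alpha> :: "nat \<Rightarrow> real"
    and c :: "nat \<Rightarrow> (nat \<Rightarrow> real) \<Rightarrow> real" and h :: "nat \<Rightarrow> real \<Rightarrow> real" and j p :: nat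
  assumes dec: "decomposition d k l" and j: "j \<in> {1..k}" and lj: "l j = 1" and \<alpha>: "0 < \<alpha> j"
    and c: "continuous_on (cube {1..d}) (c j)" "\<And>t. t \<in> cube {1..d} \<Longrightarrow> 0 < c j t"
    and h: "\<And>i. i \<in> {1..k} \<Longrightarrow> pos_cont_density (h i)"
    and p_def: "p = L l j"
begin

lemma L_pred: "L l (j - 1) + 1 = p"
  using j lj by (cases j) (auto simp: L_def p_def)

lemma p_in: "p \<in> {1..d}"
  using L_pred L_mono[of j k l] j dec by (auto simp: p_def L_def decomposition_def)

lemma insert_p: "insert p ({1..d} - {p}) = {1..d}"
  using p_in by auto

lemma component_of_p: "component_of l p = j"
  using L_pred by (intro component_of_eq) (auto simp: p_def)

text \<open>The index interval of component \<open>j\<close> contains only \<open>p\<close>.\<close>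

lemma component_of_neq: "m \<in> {1..d} - {p} \<Longrightarrow> component_of l m \<noteq> j"
  using component_of_bounds[OF dec, of m] L_pred by (auto simp: p_def)

lemma density_coordinate:
  assumes "m \<in> {1..d}"
  shows "continuous_on (cube {1..d}) (\<lambda>t. h (component_of l m) (t m))"
    and "t \<in> cube {1..d} \<Longrightarrow> 0 < h (component_of l m) (t m)"
proof -
  have dens: "pos_cont_density (h (component_of l m))"
    using component_of_bounds(1)[OF dec assms] h by blast
  have *: "t m \<in> {0..1}" if "t \<in> cube {1..d}" for t
    using that assms by (auto simp: cube_def PiE_iff)
  show "continuous_on (cube {1..d}) (\<lambda>t. h (component_of l m) (t m))"
    by (rule continuous_on_compose2[where t="{0..1}"])
       (use dens * in \<open>auto simp: pos_cont_density_def intro: continuous_on_subset[OF continuous_on_product_coordinates]\<close>)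
  show "t \<in> cube {1..d} \<Longrightarrow> 0 < h (component_of l m) (t m)"
    using dens * by (auto simp: pos_cont_density_def)
qed

text \<open>The integrand of \<open>Q_fun\<close> before its coordinate \<open>p\<close> is fixed.
  As a function of the whole vector it serves both \<open>Q_fun\<close> and
  \<open>v_const\<close>.\<close>

abbreviation "weight t \<equiv> c j t * (\<Prod>m\<in>{1..d} - {p}. 1 / h (component_of l m) (t m))"

lemma weight_continuous: "continuous_on (cube {1..d}) (\<lambda>t. weight t)"
  using density_coordinate by (intro continuous_intros c) (auto simp: less_imp_neq[symmetric])

lemma weight_pos: "t \<in> cube {1..d} \<Longrightarrow> 0 < weight t"
  using density_coordinate(2) by (intro mult_pos_pos c prod_pos) auto

text \<open>The product omits the factor at \<open>p\<close>, so updating that coordinate affects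
  only \<open>c j\<close>.\<close>

lemma Q_fun_weight: "Q_fun d l c h j x = (LINT t:cube ({1..d} - {p})|leb ({1..d} - {p}). weight (t(p := x)))"
  unfolding Q_fun_def p_def[symmetric] by (intro set_lebesgue_integral_cong) (simp_all add: sets_cube)

lemma Q_fun_continuous: "continuous_on {0..1} (Q_fun d l c h j)"
  unfolding Q_fun_weight using weight_continuous
  by (intro continuous_on_cube_integral) (simp_all only: insert_p finite_Diff finite_atLeastAtMost)

lemma Q_fun_pos: "x \<in> {0..1} \<Longrightarrow> 0 < Q_fun d l c h j x"
  unfolding Q_fun_weight
  using weight_continuous weight_pos cube_fun_upd[of _ "{1..d} - {p}" x p]
  by (intro integral_cube_pos continuous_on_cube_section[of p]) (simp_all only: insert_p finite_Diff finite_atLeastAtMost)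

lemma v_const_one_dimensional:
  assumes g: "pos_cont_density g"
  shows "v_const d l \<alpha> c (h(j := g)) j =
    a_const (\<alpha> j) * (LINT t:{0..1}|lborel. Q_fun d l c h j t * g t powr (-(1 + \<alpha> j)))"
proof -
  let ?I = "{1..d} - {p}"
  \<comment> \<open>All dependence on \<open>g\<close>: the exponent collects -\<alpha> j from the
    constant b and -1 from the product factor at \<open>p\<close>.\<close>
  let ?r = "\<lambda>x. a_const (\<alpha> j) * g x powr (-(1 + \<alpha> j))"
  let ?F = "\<lambda>t. weight t * ?r (t p)"
  have t_p: "t p \<in> {0..1}" if "t \<in> cube {1..d}" for t
    using that p_in by (auto simp: cube_def PiE_iff)
  have gpos: "0 < g x" if "x \<in> {0..1}" for x
    using g that by (simp add: pos_cont_density_def)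
  have integrand: "c j t * b_const (\<alpha> j) (l j) (\<lambda>i\<in>{1..l j}. 1 / (h(j := g)) j (block l t j i)) *
      (\<Prod>m=1..d. 1 / (h(j := g)) (component_of l m) (t m)) = ?F t" if "t \<in> cube {1..d}" for t
  proof -
    have "(\<Prod>m=1..d. 1 / (h(j := g)) (component_of l m) (t m)) =
        1 / g (t p) * (\<Prod>m\<in>?I. 1 / (h(j := g)) (component_of l m) (t m))"
      using p_in by (subst prod.remove[of _ p]) (auto simp: component_of_p)
    \<comment> \<open>The remaining coordinates belong to other components, where replacing
      \<open>h j\<close> by \<open>g\<close> has no effect.\<close>
    also have "\<dots> = 1 / g (t p) * (\<Prod>m\<in>?I. 1 / h (component_of l m) (t m))"
      using component_of_neq by (intro arg_cong2[where f="(*)"] prod.cong refl) auto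
    finally have prod: "(\<Prod>m=1..d. 1 / (h(j := g)) (component_of l m) (t m)) =
        1 / g (t p) * (\<Prod>m\<in>?I. 1 / h (component_of l m) (t m))" .
    have block: "block l t j 1 = t p" using lj L_pred by (simp add: block_def)
    have b: "b_const (\<alpha> j) (l j) (\<lambda>i\<in>{1..l j}. 1 / (h(j := g)) j (block l t j i)) =
        a_const (\<alpha> j) * (1 / g (t p)) powr \<alpha> j"
      using gpos[OF t_p[OF that]] unfolding lj b_const_one[OF \<alpha>] using block by simp
    have r: "(1 / g (t p)) powr \<alpha> j * (1 / g (t p)) = g (t p) powr (-(1 + \<alpha> j))"
      using gpos[OF t_p[OF that]] unfolding powr_minus powr_add by (simp add: divide_inverse inverse_powr)
    show ?thesis unfolding prod b r[symmetric] by (simp only: ac_simps)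
  qed
  have "continuous_on {0..1} ?r"
    using g gpos by (intro continuous_on_mult continuous_on_powr continuous_on_const)
      (force simp: pos_cont_density_def)+
  then have "continuous_on (cube {1..d}) (\<lambda>t. ?r (t p))"
    by (rule continuous_on_compose2) (use t_p in \<open>auto intro: continuous_on_subset[OF continuous_on_product_coordinates]\<close>)
  with weight_continuous have contF: "continuous_on (cube {1..d}) ?F"
    by (rule continuous_on_mult)
  have "v_const d l \<alpha> c (h(j := g)) j = (LINT t:cube {1..d}|leb {1..d}. ?F t)"
    unfolding v_const_def
    by (intro set_lebesgue_integral_cong sets_cube finite_atLeastAtMost allI impI integrand)
  \<comment> \<open>With coordinate \<open>p\<close> outermost, \<open>?r\<close> is constant in the
    inner integral, which then becomes \<open>Q_fun\<close>.\<close>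
  also have "\<dots> = (LINT x:{0..1}|lborel. LINT t:cube ?I|leb ?I. ?F (t(p := x)))"
    using integral_cube_insert[of ?I p ?F] contF by (simp only: insert_p) simp
  also have "\<dots> = (LINT x:{0..1}|lborel. a_const (\<alpha> j) * (Q_fun d l c h j x * g x powr (-(1 + \<alpha> j))))"
    unfolding Q_fun_weight fun_upd_same set_integral_mult_left by (simp only: ac_simps)
  finally show ?thesis by simp
qed

end

section \<open>The reduced formula for v and its optimal density\<close>

theorem proposition1:
  fixes M :: "'w measure" and d k :: nat and l :: "nat \<Rightarrow> nat"
    and \<alpha> :: "nat \<Rightarrow> real" and c :: "nat \<Rightarrow> (nat \<Rightarrow> real) \<Rightarrow> real"
    and X :: "(nat \<Rightarrow> real) \<Rightarrow> 'w \<Rightarrow> real"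
    and h :: "nat \<Rightarrow> real \<Rightarrow> real" and n :: "nat \<Rightarrow> nat \<Rightarrow> nat" and S :: "nat set"
    and \<eta> :: "nat \<Rightarrow> (nat \<Rightarrow> nat) \<Rightarrow> 'w \<Rightarrow> nat \<Rightarrow> real"
    and I_X :: "'w \<Rightarrow> real" and I_N :: "nat \<Rightarrow> 'w \<Rightarrow> real" and j :: nat
  assumes "prob_space M"
    and "1 \<le> d"
    and "decomposition d k l"
    and "\<forall>i\<in>{1..k}. 0 < \<alpha> i \<and> \<alpha> i < 2"
    and "locally_stationary M d k l \<alpha> c X"
    and "cross_regular k l h n S"
    and "\<forall>N\<in>S. stratified_sample M d l h n N X (\<eta> N)"
    and "I_X = field_integral d X"
    and "\<forall>N\<in>S. I_N N = stratified_quadrature d l h n N X (\<eta> N)"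
    and "j \<in> {1..k}"
    and "l j = 1"
  shows "(\<forall>g. pos_cont_density g \<longrightarrow>
           v_const d l \<alpha> c (h(j := g)) j =
             a_const (\<alpha> j) * (LINT t:{0..1}|lborel. Q_fun d l c h j t * g t powr (-(1 + \<alpha> j)))) \<and>
         (\<forall>g. is_arg_min (\<lambda>g. v_const d l \<alpha> c (h(j := g)) j) pos_cont_density g \<longleftrightarrow>
           (\<forall>t\<in>{0..1}. g t = h_opt d l \<alpha> c h j t)) \<and>
         v_const d l \<alpha> c (h(j := h_opt d l \<alpha> c h j)) j =
           a_const (\<alpha> j) *
             (LINT t:{0..1}|lborel. Q_fun d l c h j t powr (1 / (2 + \<alpha> j))) powr
               (1 / (1 / (2 + \<alpha> j)))"
proof -
  let ?q = "Q_fun d l c h j" and ?f = "h_opt d l \<alpha> c h j"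
  let ?v = "\<lambda>g. v_const d l \<alpha> c (h(j := g)) j"
  have \<alpha>: "0 < \<alpha> j"
    and c: "continuous_on (cube {1..d}) (c j)" "\<And>t. t \<in> cube {1..d} \<Longrightarrow> 0 < c j t"
    and h: "\<And>i. i \<in> {1..k} \<Longrightarrow> pos_cont_density (h i)"
    using assms by (auto simp: locally_stationary_def local_coefficients_def cross_regular_def)
  \<comment> \<open>The final \<open>refl\<close> discharges the defining equation of
    \<open>p\<close> once \<open>p\<close> is instantiated to \<open>L l j\<close>.\<close>
  note ctx = \<open>decomposition d k l\<close> \<open>j \<in> {1..k}\<close> \<open>l j = 1\<close> \<alpha> c h refl
  have v: "?v g = a_const (\<alpha> j) * (LINT t:{0..1}|lborel. ?q t * g t powr (-(1 + \<alpha> j)))"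
    if "pos_cont_density g" for g
    by (rule v_const_one_dimensional[where d=d and k=k and l=l and \<alpha>=\<alpha> and c=c and h=h and j=j
      and p="L l j",
        OF ctx that])
  have Q: "continuous_on {0..1} ?q"
    by (rule Q_fun_continuous[where d=d and k=k and l=l and \<alpha>=\<alpha> and c=c and h=h and j=j
      and p="L l j", OF ctx])
  have Q_pos: "\<forall>t\<in>{0..1}. 0 < ?q t"
    by (rule ballI, rule Q_fun_pos[where d=d and k=k and l=l and \<alpha>=\<alpha> and c=c and h=h and j=j
      and p="L l j", OF ctx])
  have f: "?f = (\<lambda>t. ?q t powr (1 / (2 + \<alpha> j)) / (LINT t:{0..1}|lborel. ?q t powr (1 / (2 + \<alpha> j))))"
    by (simp add: h_opt_def fun_eq_iff)
  note min = powr_density_minimization[OF Q Q_pos \<alpha> f]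
  \<comment> \<open>Positivity of this factor carries comparisons between \<open>?v\<close> and the
    reduced integral in both directions.\<close>
  have a: "0 < a_const (\<alpha> j)" using \<alpha> by (simp add: a_const_def)
  have le: "?v ?f \<le> ?v g" if "pos_cont_density g" for g
    using min(3)[OF that] a by (simp add: v that min(1))
  \<comment> \<open>Together with minimality of \<open>?f\<close>, the assumed inequality becomes an
    equality, to which the uniqueness claim applies.\<close>
  have eq: "g t = ?f t" if "pos_cont_density g" "?v g \<le> ?v ?f" "t \<in> {0..1}" for g t
    using that min(3)[OF that(1)] a by (intro min(4)) (simp_all add: v min(1))
  have "is_arg_min ?v pos_cont_density g \<longleftrightarrow> (\<forall>t\<in>{0..1}. g t = ?f t)" for g
  proof
    assume "is_arg_min ?v pos_cont_density g"
    then have "pos_cont_density g" "?v g \<le> ?v ?f"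
      using min(1) by (simp_all only: is_arg_min_linorder)
    then show "\<forall>t\<in>{0..1}. g t = ?f t"
      by (intro ballI eq)
  next
    assume g: "\<forall>t\<in>{0..1}. g t = ?f t"
    then have dens: "pos_cont_density g"
      by (intro pos_cont_density_cong[OF min(1)] bspec[OF g])
    \<comment> \<open>By the reduced formula, \<open>?v\<close> sees a density only through its
      values on the unit interval.\<close>
    have "?v g = ?v ?f"
      unfolding v[OF dens] v[OF min(1)]
      using g by (intro arg_cong[where f="(*) _"] set_lebesgue_integral_cong) auto
    then show "is_arg_min ?v pos_cont_density g"
      using dens le by (simp add: is_arg_min_linorder del: fun_upd_apply)
  qed
  moreover have "\<forall>g. pos_cont_density g \<longrightarrow>
      ?v g = a_const (\<alpha> j) * (LINT t:{0..1}|lborel. ?q t * g t powr (-(1 + \<alpha> j)))"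
    using v by (intro allI impI)
  moreover have "?v ?f = a_const (\<alpha> j) *
      (LINT t:{0..1}|lborel. ?q t powr (1 / (2 + \<alpha> j))) powr (1 / (1 / (2 + \<alpha> j)))"
    unfolding v[OF min(1)] min(2) by simp
  ultimately show ?thesis
    by blast
qed

end
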